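(* Let $A$ be a $C^*$-algebra. Then the assignment $I\mapsto T(I)$ defines a bijection from the set (a) to the set (b), where: (a) is the set of semiprime two-sided ideals $I$ in $A$ such that $A/I$ contains no nonzero, commutative two-sided ideal; (b) is the set of semiprime Lie ideals in $A$. The inverse of this assignment maps a semiprime Lie ideal $L$ in $A$ to the largest two-sided ideal $I(L)$ of $A$ contained in $L$. Further, this bijection restricts to a bijection from the set (a') to the set (b'), where: (a') is the set of prime two-sided ideals $I$ in $A$ such that $A/I$ contains no nonzero, commutative two-sided ideal; (b') is the set of prime Lie ideals in $A$.
   Context: A $C^*$-algebra $A$ need not be unital. For $a,b\in A$ put $[a,b]:=ab-ba$; for subsets $E,F\subseteq A$, $[E,F]$ denotes the linear span of $\{[a,b]:a\in E,b\in F\}$. A two-sided ideal in $A$ is a linear subspace $I\subseteq A$ (not necessarily closed) with $ax,xa\in I$ for all $a\in A$, $x\in I$; the quotient $A/I$ is an algebraic quotient. Every linear subspace of $A$ contains a unique largest two-sided ideal of $A$. A two-sided ideal $I$ is prime if $I\neq A$ and, for all two-sided ideals $I_1,I_2$, $I_1I_2\subseteq I$ implies $I_1\subseteq I$ or $I_2\subseteq I$; it is semiprime if for every two-sided ideal $J$, $J^2\subseteq I$ implies $J\subseteq I$ (equivalently, $I$ is an intersection of prime ideals, with $A$ itself being the empty intersection). A Lie ideal in $A$ is a linear subspace $L\subseteq A$ (not necessarily closed) with $[A,L]\subseteq L$. A Lie ideal $L$ is prime if $L\neq A$ and, for all Lie ideals $K_1,K_2\subseteq A$ with $[K_1,K_2]\subseteq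 L$, one has $K_1\subseteq L$ or $K_2\subseteq L$. A Lie ideal $L$ is semiprime if for every Lie ideal $K\subseteq A$ with $[K,K]\subseteq L$ one has $K\subseteq L$. For a linear subspace $L\subseteq A$, the full normalizer subspace is $T(L):=\{a\in A:[A,a]\subseteq L\}$. *)

theory Defs
  imports "HOL-Analysis.Analysis"
begin

class complex_vector = real_vector +
  fixes scaleC :: "complex \<Rightarrow> 'a \<Rightarrow> 'a" (infixr "*\<^sub>C" 75)
  assumes scaleC_add_right: "c *\<^sub>C (x + y) = c *\<^sub>C x + c *\<^sub>C y"
    and scaleC_add_left: "(c + d) *\<^sub>C x = c *\<^sub>C x + d *\<^sub>C x"
    and scaleC_scaleC: "c *\<^sub>C (d *\<^sub>C x) = (c * d) *\<^sub>C x"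
    and scaleC_of_real: "complex_of_real r *\<^sub>C x = r *\<^sub>R x"

lemma vector_space_scaleC:
  "vector_space (scaleC :: complex \<Rightarrow> 'a \<Rightarrow> 'a::complex_vector)"
  by unfold_locales
    (simp_all add: scaleC_add_right scaleC_add_left scaleC_scaleC
      scaleC_of_real[of 1, simplified])

global_interpretation complex_vector:
  vector_space "scaleC :: complex \<Rightarrow> 'a \<Rightarrow> 'a::complex_vector"
  by (rule vector_space_scaleC)

abbreviation csubspace :: "'a::complex_vector set \<Rightarrow> bool"
  where "csubspace \<equiv> complex_vector.subspace"

abbreviation cspan :: "'a::complex_vector set \<Rightarrow> 'a set"
  where "cspan \<equiv> complex_vector.span"

text \<open>No unit is assumed: the class \<open>real_normed_algebra\<close> is built on non-unital rings,
  and the zero algebra is allowed.\<close>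

class cstar_algebra = complex_vector + real_normed_algebra + banach +
  fixes star :: "'a \<Rightarrow> 'a"
  assumes scaleC_mult_left: "(c *\<^sub>C x) * y = c *\<^sub>C (x * y)"
    and scaleC_mult_right: "x * (c *\<^sub>C y) = c *\<^sub>C (x * y)"
    and norm_scaleC: "norm (c *\<^sub>C x) = cmod c * norm x"
    and star_star: "star (star x) = x"
    and star_add: "star (x + y) = star x + star y"
    and star_scaleC: "star (c *\<^sub>C x) = cnj c *\<^sub>C star x"
    and star_mult: "star (x * y) = star y * star x"
    and cstar_identity: "norm (star x * x) = (norm x)\<^sup>2"

text \<open>Ideals and Lie ideals are complex linear subspaces and need not be closed.\<close>

definition two_sided_ideal :: "'a::cstar_algebra set \<Rightarrow> bool"
  where "two_sided_ideal I \<longleftrightarrow>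
    csubspace I \<and> (\<forall>a. \<forall>x\<in>I. a * x \<in> I \<and> x * a \<in> I)"

definition ideal_product :: "'a::cstar_algebra set \<Rightarrow> 'a set \<Rightarrow> 'a set"
  where "ideal_product I J = cspan {x * y | x y. x \<in> I \<and> y \<in> J}"

definition prime_ideal :: "'a::cstar_algebra set \<Rightarrow> bool"
  where "prime_ideal I \<longleftrightarrow> two_sided_ideal I \<and> I \<noteq> UNIV \<and>
    (\<forall>I1 I2. two_sided_ideal I1 \<longrightarrow> two_sided_ideal I2 \<longrightarrow>
      ideal_product I1 I2 \<subseteq> I \<longrightarrow> I1 \<subseteq> I \<or> I2 \<subseteq> I)"

definition semiprime_ideal :: "'a::cstar_algebra set \<Rightarrow> bool"
  where "semiprime_ideal I \<longleftrightarrow> two_sided_ideal I \<and>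
    (\<forall>J. two_sided_ideal J \<longrightarrow> ideal_product J J \<subseteq> I \<longrightarrow> J \<subseteq> I)"

definition largest_ideal :: "'a::cstar_algebra set \<Rightarrow> 'a set"
  where "largest_ideal L = (GREATEST I. two_sided_ideal I \<and> I \<subseteq> L)"

text \<open>The largest ideal exists in every linear subspace, so the description above is never
  an unspecified set there.\<close>

lemma largest_ideal:
  assumes "csubspace L"
  shows "two_sided_ideal (largest_ideal L)"
    and "largest_ideal L \<subseteq> L"
    and "\<And>J. two_sided_ideal J \<Longrightarrow> J \<subseteq> L \<Longrightarrow> J \<subseteq> largest_ideal L"
proof -
  let ?U = "\<Union>{I. two_sided_ideal I \<and> I \<subseteq> L}"
  let ?M = "cspan ?U"
  have closed: "a * x \<in> ?M \<and> x * a \<in> ?M" if "x \<in> ?M" for a x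
    using that
  proof (induction rule: complex_vector.span_induct_alt)
    case base
    show ?case by (simp add: complex_vector.span_zero)
  next
    case (step c x y)
    have "a * x \<in> ?U" "x * a \<in> ?U"
      using step(1) unfolding two_sided_ideal_def by blast+
    then show ?case
      using step(2)
      by (simp add: distrib_left distrib_right scaleC_mult_left scaleC_mult_right
          complex_vector.span_add complex_vector.span_scale complex_vector.span_base)
  qed
  have M: "two_sided_ideal ?M \<and> ?M \<subseteq> L"
    using closed complex_vector.span_minimal[of ?U L] assms
    by (auto simp: two_sided_ideal_def)
  have max: "J \<subseteq> ?M" if "two_sided_ideal J \<and> J \<subseteq> L" for J
    using that complex_vector.span_superset[of ?U] by blast
  have "largest_ideal L = ?M"
    unfolding largest_ideal_def by (rule Greatest_equality) (use M max in auto)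
  then show "two_sided_ideal (largest_ideal L)" "largest_ideal L \<subseteq> L"
    "\<And>J. two_sided_ideal J \<Longrightarrow> J \<subseteq> L \<Longrightarrow> J \<subseteq> largest_ideal L"
    using M max by auto
qed

definition coset :: "'a::cstar_algebra set \<Rightarrow> 'a \<Rightarrow> 'a set"
  where "coset I a = {a + x | x. x \<in> I}"

definition quotient_algebra :: "'a::cstar_algebra set \<Rightarrow> 'a set set"
  where "quotient_algebra I = range (coset I)"

text \<open>The operations of \<open>A/I\<close> are unions of cosets over all representatives; when \<open>I\<close> is a
  two-sided ideal all these cosets coincide (see the lemmas below). The zero of \<open>A/I\<close>
  is \<open>coset I 0\<close>, that is, \<open>I\<close>.\<close>

definition quotient_add :: "'a::cstar_algebra set \<Rightarrow> 'a set \<Rightarrow> 'a set \<Rightarrow> 'a set"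
  where "quotient_add I X Y = (\<Union>x\<in>X. \<Union>y\<in>Y. coset I (x + y))"

definition quotient_scale :: "'a::cstar_algebra set \<Rightarrow> complex \<Rightarrow> 'a set \<Rightarrow> 'a set"
  where "quotient_scale I c X = (\<Union>x\<in>X. coset I (c *\<^sub>C x))"

definition quotient_mult :: "'a::cstar_algebra set \<Rightarrow> 'a set \<Rightarrow> 'a set \<Rightarrow> 'a set"
  where "quotient_mult I X Y = (\<Union>x\<in>X. \<Union>y\<in>Y. coset I (x * y))"

lemma coset_eq_iff:
  assumes "two_sided_ideal I"
  shows "coset I a = coset I b \<longleftrightarrow> a - b \<in> I"
proof
  have I: "csubspace I" using assms by (simp add: two_sided_ideal_def)
  {
    assume "coset I a = coset I b"
    moreover have "a + 0 \<in> coset I a"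
      using complex_vector.subspace_0[OF I] by (auto simp: coset_def)
    ultimately obtain x where "x \<in> I" "a = b + x" by (auto simp: coset_def)
    then show "a - b \<in> I" by simp
  }
  assume d: "a - b \<in> I"
  have "coset I a \<subseteq> coset I b" if "a - b \<in> I" for a b
  proof
    fix y assume "y \<in> coset I a"
    then obtain x where "x \<in> I" "y = a + x" by (auto simp: coset_def)
    then have "y = b + ((a - b) + x)" "(a - b) + x \<in> I"
      using that complex_vector.subspace_add[OF I] by auto
    then show "y \<in> coset I b" unfolding coset_def by blast
  qed
  from this[of a b] this[of b a] show "coset I a = coset I b"
    using d complex_vector.subspace_neg[OF I, of "a - b"] by auto
qed

lemma coset_self: "two_sided_ideal I \<Longrightarrow> a \<in> coset I a"
  using complex_vector.subspace_0[of I] by (force simp: coset_def two_sided_ideal_def)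

lemma quotient_add_coset:
  assumes "two_sided_ideal I"
  shows "quotient_add I (coset I a) (coset I b) = coset I (a + b)"
proof -
  have I: "csubspace I" using assms by (simp add: two_sided_ideal_def)
  have "coset I (x + y) = coset I (a + b)" if "x \<in> coset I a" "y \<in> coset I b" for x y
    using that complex_vector.subspace_add[OF I]
    by (auto simp: coset_eq_iff[OF assms]) (auto simp: coset_def algebra_simps)
  then show ?thesis
    using coset_self[OF assms] unfolding quotient_add_def by blast
qed

lemma quotient_scale_coset:
  assumes "two_sided_ideal I"
  shows "quotient_scale I c (coset I a) = coset I (c *\<^sub>C a)"
proof -
  have I: "csubspace I" using assms by (simp add: two_sided_ideal_def)
  have "coset I (c *\<^sub>C x) = coset I (c *\<^sub>C a)" if "x \<in> coset I a" for x
    using that complex_vector.subspace_scale[OF I]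
    by (auto simp: coset_eq_iff[OF assms]) (auto simp: coset_def scaleC_add_right)
  then show ?thesis
    using coset_self[OF assms] unfolding quotient_scale_def by blast
qed

lemma quotient_mult_coset:
  assumes "two_sided_ideal I"
  shows "quotient_mult I (coset I a) (coset I b) = coset I (a * b)"
proof -
  have I: "csubspace I" using assms by (simp add: two_sided_ideal_def)
  have "coset I (x * y) = coset I (a * b)" if xy: "x \<in> coset I a" "y \<in> coset I b" for x y
  proof -
    obtain u v where uv: "u \<in> I" "v \<in> I" "x = a + u" "y = b + v"
      using xy by (auto simp: coset_def)
    have "x * y - a * b = a * v + u * (b + v)"
      by (simp add: uv algebra_simps)
    moreover have "a * v \<in> I" "u * (b + v) \<in> I"
      using uv assms by (auto simp: two_sided_ideal_def)
    ultimately show ?thesis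
      using complex_vector.subspace_add[OF I] by (simp add: coset_eq_iff[OF assms])
  qed
  then show ?thesis
    using coset_self[OF assms] unfolding quotient_mult_def by blast
qed

definition quotient_ideal :: "'a::cstar_algebra set \<Rightarrow> 'a set set \<Rightarrow> bool"
  where "quotient_ideal I J \<longleftrightarrow>
    J \<subseteq> quotient_algebra I \<and>
    coset I 0 \<in> J \<and>
    (\<forall>X\<in>J. \<forall>Y\<in>J. quotient_add I X Y \<in> J) \<and>
    (\<forall>c. \<forall>X\<in>J. quotient_scale I c X \<in> J) \<and>
    (\<forall>X\<in>quotient_algebra I. \<forall>Y\<in>J. quotient_mult I X Y \<in> J \<and> quotient_mult I Y X \<in> J)"

definition quotient_no_commutative_ideal :: "'a::cstar_algebra set \<Rightarrow> bool"
  where "quotient_no_commutative_ideal I \<longleftrightarrow>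
    \<not> (\<exists>J. quotient_ideal I J \<and> J \<noteq> {coset I 0} \<and>
          (\<forall>X\<in>J. \<forall>Y\<in>J. quotient_mult I X Y = quotient_mult I Y X))"

definition commutator_span :: "'a::cstar_algebra set \<Rightarrow> 'a set \<Rightarrow> 'a set"
  where "commutator_span E F = cspan {a * b - b * a | a b. a \<in> E \<and> b \<in> F}"

definition lie_ideal :: "'a::cstar_algebra set \<Rightarrow> bool"
  where "lie_ideal L \<longleftrightarrow> csubspace L \<and> commutator_span UNIV L \<subseteq> L"

definition prime_lie_ideal :: "'a::cstar_algebra set \<Rightarrow> bool"
  where "prime_lie_ideal L \<longleftrightarrow> lie_ideal L \<and> L \<noteq> UNIV \<and>
    (\<forall>K1 K2. lie_ideal K1 \<longrightarrow> lie_ideal K2 \<longrightarrow>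
      commutator_span K1 K2 \<subseteq> L \<longrightarrow> K1 \<subseteq> L \<or> K2 \<subseteq> L)"

definition semiprime_lie_ideal :: "'a::cstar_algebra set \<Rightarrow> bool"
  where "semiprime_lie_ideal L \<longleftrightarrow> lie_ideal L \<and>
    (\<forall>K. lie_ideal K \<longrightarrow> commutator_span K K \<subseteq> L \<longrightarrow> K \<subseteq> L)"

definition full_normalizer :: "'a::cstar_algebra set \<Rightarrow> 'a set"
  where "full_normalizer L = {a. commutator_span UNIV {a} \<subseteq> L}"

end

theory Submission
  imports Defs
begin

text \<open>
  The proof is Herstein's Lie theory of associative rings, carried out in quotients of \<open>A\<close>.  For a
  two-sided ideal \<open>I\<close>, the set \<open>T(I)\<close> is the preimage of the centre of \<open>A/I\<close>.

  From ideals to Lie ideals, the point is that in a semiprime quotient a weak form of centrality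
  implies centrality.  If \<open>[k,[k,x]]\<close> vanishes in \<open>A/I\<close> for all \<open>x\<close>,
  then the derivation \<open>d = [k,\<sqdot>]\<close> satisfies \<open>0 = d\<^sup>2(xy) = 2 d(x) d(y)\<close>, and therefore
  \<open>d(x) y d(x) = 0\<close>, which forces \<open>d = 0\<close> (\<open>full_normalizer_if_double_commutator_zero\<close>).  This still
  works if \<open>[k,[k,x]]\<close> is merely central (\<open>full_normalizer_if_double_commutator_central\<close>), so a Lie
  ideal \<open>K\<close> with \<open>[K,K] \<subseteq> T(I)\<close> lies in \<open>T(I)\<close>.  For prime \<open>I\<close> and Lie ideals with
  \<open>[K\<^sub>1,K\<^sub>2] \<subseteq> T(I)\<close>, one gets \<open>[K\<^sub>1,K\<^sub>2] \<subseteq> I\<close>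
  (\<open>commutator_zero_if_mixed_double_commutator_central\<close>).  Then \<open>[u,[v,x]]\<close> vanishes in \<open>A/I\<close> for
  \<open>u \<in> K\<^sub>1\<close> and \<open>v \<in> K\<^sub>2\<close>, and by Posner's theorem on compositions of two derivations of a prime ring,
  \<open>u\<close> or \<open>v\<close> is central (\<open>full_normalizer_if_mixed_double_commutator_zero\<close>).

  From Lie ideals to ideals, let \<open>L\<close> be a semiprime Lie ideal.  As \<open>[T(L),T(L)] \<subseteq> L\<close>, semiprimeness
  gives \<open>T(L) = L\<close>; but a full normalizer is closed under multiplication, so \<open>L\<close> is a subalgebra.  For
  a subalgebra that is a Lie ideal, the two-sided ideal generated by \<open>[L,L]\<close> stays inside \<open>L\<close>
  (\<open>commutator_in_largest_ideal\<close>), that is, \<open>[L,L] \<subseteq> I(L)\<close>.  Hence \<open>L\<close> becomes a commutative Lie ideal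
  in the semiprime quotient \<open>A/I(L)\<close>, where such a Lie ideal is central, and \<open>L = T(I(L))\<close> follows.

  Finally, \<open>I(T(I))\<close> is the preimage of the largest central ideal of \<open>A/I\<close>, so the absence of
  commutative ideals in \<open>A/I\<close> is what makes \<open>I\<close> recoverable from \<open>T(I)\<close>.
\<close>

section \<open>Elementwise descriptions\<close>

text \<open>A definition rather than an abbreviation: \<open>[x,y]\<close> often lies in an ideal although
  \<open>xy\<close> and \<open>yx\<close> do not, so backward reasoning should not treat it as a difference of two members.\<close>

definition commutator :: "'a::ring \<Rightarrow> 'a \<Rightarrow> 'a"
  where "commutator x y = x * y - y * x"

lemma commutator_span_subset_iff:
  assumes "csubspace L"
  shows "commutator_span E F \<subseteq> L \<longleftrightarrow> (\<forall>a\<in>E. \<forall>b\<in>F. commutator a b \<in> L)"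
proof -
  let ?S = "{a * b - b * a | a b. a \<in> E \<and> b \<in> F}"
  have "cspan ?S \<subseteq> L \<longleftrightarrow> ?S \<subseteq> L"
    using complex_vector.span_minimal[OF _ assms, of ?S] complex_vector.span_superset[of ?S] by blast
  then show ?thesis unfolding commutator_span_def commutator_def by blast
qed

lemma ideal_product_subset_iff:
  assumes "csubspace L"
  shows "ideal_product I J \<subseteq> L \<longleftrightarrow> (\<forall>x\<in>I. \<forall>y\<in>J. x * y \<in> L)"
proof -
  let ?S = "{x * y | x y. x \<in> I \<and> y \<in> J}"
  have "cspan ?S \<subseteq> L \<longleftrightarrow> ?S \<subseteq> L"
    using complex_vector.span_minimal[OF _ assms, of ?S] complex_vector.span_superset[of ?S] by blast
  then show ?thesis unfolding ideal_product_def by blast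
qed

lemma mem_full_normalizer_iff:
  "csubspace L \<Longrightarrow> a \<in> full_normalizer L \<longleftrightarrow> (\<forall>x. commutator x a \<in> L)"
  by (simp add: full_normalizer_def commutator_span_subset_iff)

lemma lie_ideal_iff:
  "lie_ideal L \<longleftrightarrow> csubspace L \<and> (\<forall>a. \<forall>x\<in>L. commutator a x \<in> L)"
  unfolding lie_ideal_def using commutator_span_subset_iff[of L UNIV L] by blast

lemma mem_if_eq: "x = y \<Longrightarrow> y \<in> S \<Longrightarrow> x \<in> S"
  by simp

lemma commutator_swap_mem:
  assumes "csubspace L" "commutator a b \<in> L"
  shows "commutator b a \<in> L"
  using complex_vector.subspace_neg[OF assms] by (simp add: commutator_def)

text \<open>The invertibility of 2 enters the whole development through this lemma.\<close>

lemma csubspace_halve: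
  fixes w :: "'a::complex_vector"
  assumes "csubspace L" "w + w \<in> L"
  shows "w \<in> L"
proof -
  have "w = (1/2) *\<^sub>C (w + w)"
    by (simp add: scaleC_add_right scaleC_add_left[symmetric])
  then show ?thesis
    using complex_vector.subspace_scale[OF assms, of "1/2"] by simp
qed

lemma two_sided_ideal_csubspace: "two_sided_ideal I \<Longrightarrow> csubspace I"
  and two_sided_ideal_mult_left: "two_sided_ideal I \<Longrightarrow> x \<in> I \<Longrightarrow> a * x \<in> I"
  and two_sided_ideal_mult_right: "two_sided_ideal I \<Longrightarrow> x \<in> I \<Longrightarrow> x * a \<in> I"
  and two_sided_ideal_add: "two_sided_ideal I \<Longrightarrow> x \<in> I \<Longrightarrow> y \<in> I \<Longrightarrow> x + y \<in> I"
  and two_sided_ideal_diff: "two_sided_ideal I \<Longrightarrow> x \<in> I \<Longrightarrow> y \<in> I \<Longrightarrow> x - y \<in> I"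
  by (simp_all add: two_sided_ideal_def complex_vector.subspace_add complex_vector.subspace_diff)

lemmas two_sided_ideal_closed =
  two_sided_ideal_mult_left two_sided_ideal_mult_right two_sided_ideal_add two_sided_ideal_diff

lemma two_sided_ideal_lie_ideal: "two_sided_ideal I \<Longrightarrow> lie_ideal I"
  by (simp add: lie_ideal_iff commutator_def two_sided_ideal_csubspace two_sided_ideal_closed)

section \<open>Prime and semiprime ideals in terms of elements\<close>

text \<open>Without a unit the principal ideal generated by \<open>x\<close> is awkward to write down.  The following
  ideal quotients serve instead as ideals that contain \<open>x\<close> and multiply into \<open>I\<close>.\<close>

lemma two_sided_ideal_right_quotient:
  assumes "two_sided_ideal I"
  shows "two_sided_ideal {w. \<forall>s\<in>S. \<forall>a. s * a * w \<in> I}"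
  using assms
  by (auto simp: two_sided_ideal_def complex_vector.subspace_def distrib_left scaleC_mult_right)
    (metis mult.assoc)+

lemma two_sided_ideal_left_quotient:
  assumes "two_sided_ideal I"
  shows "two_sided_ideal {v. \<forall>s\<in>S. \<forall>a. v * a * s \<in> I}"
  using assms
  by (auto simp: two_sided_ideal_def complex_vector.subspace_def distrib_right scaleC_mult_left)
    (metis mult.assoc)+

lemma two_sided_ideal_right_quotient_ideal:
  assumes "two_sided_ideal I" "two_sided_ideal J"
  shows "two_sided_ideal {u. \<forall>v\<in>J. v * u \<in> I}"
  using assms
  by (auto simp: two_sided_ideal_def complex_vector.subspace_def distrib_left scaleC_mult_right)
    (metis mult.assoc)+

lemma two_sided_ideal_Int:
  "two_sided_ideal I \<Longrightarrow> two_sided_ideal J \<Longrightarrow> two_sided_ideal (I \<inter> J)"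
  by (simp add: two_sided_ideal_def complex_vector.subspace_inter)

lemma semiprime_ideal_two_sided: "semiprime_ideal I \<Longrightarrow> two_sided_ideal I"
  by (simp add: semiprime_ideal_def)

lemma semiprime_idealD:
  assumes "semiprime_ideal I" "two_sided_ideal J" "\<And>x y. x \<in> J \<Longrightarrow> y \<in> J \<Longrightarrow> x * y \<in> I"
  shows "J \<subseteq> I"
  using assms
  by (auto simp: semiprime_ideal_def ideal_product_subset_iff two_sided_ideal_csubspace)

lemma prime_idealD:
  assumes "prime_ideal I" "two_sided_ideal J" "two_sided_ideal K"
    and "\<And>x y. x \<in> J \<Longrightarrow> y \<in> K \<Longrightarrow> x * y \<in> I"
  shows "J \<subseteq> I \<or> K \<subseteq> I"
  using assms
  by (simp add: prime_ideal_def ideal_product_subset_iff two_sided_ideal_csubspace)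

lemma prime_ideal_semiprime: "prime_ideal I \<Longrightarrow> semiprime_ideal I"
  by (auto simp: prime_ideal_def semiprime_ideal_def)

text \<open>The ideal \<open>J\<close> below contains \<open>x\<close> and satisfies \<open>J\<^sup>3 \<subseteq> I\<close>; the missing unit is the reason why one
  only gets a cube.  The ideal \<open>M\<close>, which contains \<open>J\<^sup>2\<close> and squares into \<open>I\<close>, repairs this.\<close>

lemma semiprime_ideal_elementwise:
  assumes I: "semiprime_ideal I" and x: "\<And>a. x * a * x \<in> I"
  shows "x \<in> I"
proof -
  note ideal = semiprime_ideal_two_sided[OF I]
  define R where "R = {w. \<forall>s\<in>{x}. \<forall>a. s * a * w \<in> I}"
  define J where "J = {v. \<forall>s\<in>R. \<forall>a. v * a * s \<in> I} \<inter> R"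
  define M where "M = {u. \<forall>v\<in>J. v * u \<in> I} \<inter> J"
  have J: "two_sided_ideal J"
    unfolding J_def R_def
    by (intro two_sided_ideal_Int two_sided_ideal_left_quotient two_sided_ideal_right_quotient ideal)
  have M: "two_sided_ideal M"
    unfolding M_def by (intro two_sided_ideal_Int two_sided_ideal_right_quotient_ideal ideal J)
  have "M \<subseteq> I"
    by (rule semiprime_idealD[OF I M]) (auto simp: M_def)
  moreover have "u * w \<in> M" if "u \<in> J" "w \<in> J" for u w
  proof -
    have "v * (u * w) \<in> I" if "v \<in> J" for v
      using that \<open>w \<in> J\<close> by (auto simp: J_def mult.assoc)
    then show ?thesis
      using two_sided_ideal_mult_left[OF J \<open>w \<in> J\<close>] by (simp add: M_def)
  qed
  ultimately have "J \<subseteq> I"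
    by (intro semiprime_idealD[OF I J]) blast
  moreover have "x \<in> J"
    using x by (simp add: J_def R_def)
  ultimately show ?thesis by blast
qed

text \<open>Again \<open>x \<in> J\<close> and \<open>y \<in> R\<close> with \<open>J R\<^sup>2 \<subseteq> I\<close>.  Primeness is applied to \<open>J\<close> and to the ideal \<open>M\<close> of
  all \<open>u\<close> with \<open>J u \<subseteq> I\<close>, which contains \<open>R\<^sup>2\<close>.\<close>

lemma prime_ideal_elementwise:
  assumes I: "prime_ideal I" and xy: "\<And>a. x * a * y \<in> I"
  shows "x \<in> I \<or> y \<in> I"
proof -
  have ideal: "two_sided_ideal I" using I by (simp add: prime_ideal_def)
  define R where "R = {w. \<forall>s\<in>{x}. \<forall>a. s * a * w \<in> I}"
  define J where "J = {v. \<forall>s\<in>R. \<forall>a. v * a * s \<in> I}"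
  define M where "M = {u. \<forall>v\<in>J. v * u \<in> I}"
  have R: "two_sided_ideal R"
    unfolding R_def by (rule two_sided_ideal_right_quotient[OF ideal])
  have J: "two_sided_ideal J"
    unfolding J_def by (rule two_sided_ideal_left_quotient[OF ideal])
  have M: "two_sided_ideal M"
    unfolding M_def by (rule two_sided_ideal_right_quotient_ideal[OF ideal J])
  have x: "x \<in> J" and y: "y \<in> R"
    using xy by (auto simp: J_def R_def)
  have "J \<subseteq> I \<or> M \<subseteq> I"
    by (rule prime_idealD[OF I J M]) (auto simp: M_def)
  moreover have "R \<subseteq> I" if "M \<subseteq> I"
  proof (rule semiprime_idealD[OF prime_ideal_semiprime[OF I] R])
    fix u w assume "u \<in> R" "w \<in> R"
    then have "u * w \<in> M"
      by (simp add: M_def J_def mult.assoc[symmetric])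
    then show "u * w \<in> I" using that by blast
  qed
  ultimately show ?thesis using x y by blast
qed

section \<open>Centrality in semiprime and prime quotients\<close>

text \<open>The inner derivation \<open>d = [k,\<sqdot>]\<close> satisfies \<open>d\<^sup>2 = 0\<close> on \<open>A/I\<close>.  By the Leibniz rule
  \<open>d\<^sup>2(xy) = 2 d(x) d(y)\<close>, so all products \<open>d(x) d(y)\<close> vanish, and then
  \<open>d(x) y d(x) = d(x) d(yx) - d(x) d(y) x\<close> vanishes as well.\<close>

lemma full_normalizer_if_double_commutator_zero:
  assumes I: "semiprime_ideal I"
    and kk: "\<And>x. commutator k (commutator k x) \<in> I"
  shows "k \<in> full_normalizer I"
proof -
  note ideal = semiprime_ideal_two_sided[OF I]
  note sub = two_sided_ideal_csubspace[OF ideal]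
  have prod: "commutator k x * commutator k y \<in> I" for x y
  proof (rule csubspace_halve[OF sub])
    have "commutator k x * commutator k y + commutator k x * commutator k y
      = commutator k (commutator k (x * y))
        - commutator k (commutator k x) * y - x * commutator k (commutator k y)"
      by (simp add: commutator_def algebra_simps)
    then show "commutator k x * commutator k y + commutator k x * commutator k y \<in> I"
      by (rule mem_if_eq) (intro kk two_sided_ideal_closed ideal)
  qed
  have "commutator k x \<in> I" for x
  proof (rule semiprime_ideal_elementwise[OF I])
    fix y
    have "commutator k x * y * commutator k x
      = commutator k x * commutator k (y * x) - commutator k x * commutator k y * x"
      by (simp add: commutator_def algebra_simps)
    then show "commutator k x * y * commutator k x \<in> I"
      by (rule mem_if_eq) (intro prod two_sided_ideal_closed ideal)
  qed
  then show ?thesis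
    using commutator_swap_mem[OF sub] by (simp add: mem_full_normalizer_iff[OF sub])
qed

text \<open>Put \<open>z = [k,[k,x]]\<close>, a central element of \<open>A/I\<close>.  Then \<open>kz = [k,[k,kx]]\<close> is central too, so
  \<open>[k,y] z = 0\<close> for all \<open>y\<close>.  For \<open>y = [k,x]\<close> this reads \<open>z\<^sup>2 = 0\<close>, and a semiprime ring has no
  nonzero central element of square zero.\<close>

lemma full_normalizer_if_double_commutator_central:
  assumes I: "semiprime_ideal I"
    and kk: "\<And>x. commutator k (commutator k x) \<in> full_normalizer I"
  shows "k \<in> full_normalizer I"
proof (rule full_normalizer_if_double_commutator_zero[OF I])
  fix x
  note ideal = semiprime_ideal_two_sided[OF I]
  note sub = two_sided_ideal_csubspace[OF ideal]
  have central: "commutator y (commutator k (commutator k x)) \<in> I" for x y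
    using kk by (simp add: mem_full_normalizer_iff[OF sub])
  define z where "z = commutator k (commutator k x)"
  have zc: "commutator y z \<in> I" for y
    unfolding z_def by (rule central)
  have kz: "commutator y (k * z) \<in> I" for y
  proof -
    have "k * z = commutator k (commutator k (k * x))"
      by (simp add: z_def commutator_def algebra_simps)
    then show ?thesis using central[of y "k * x"] by simp
  qed
  have "z * z = k * commutator (commutator k x) z - commutator (commutator k x) (k * z)"
    by (simp add: z_def commutator_def algebra_simps)
  then have zz: "z * z \<in> I"
    by (rule mem_if_eq) (intro zc kz two_sided_ideal_closed ideal)
  have "z \<in> I"
  proof (rule semiprime_ideal_elementwise[OF I])
    fix a
    have "z * a * z = z * commutator a z + z * z * a"
      by (simp add: commutator_def algebra_simps)
    then show "z * a * z \<in> I"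
      by (rule mem_if_eq) (intro zc zz two_sided_ideal_closed ideal)
  qed
  then show "commutator k (commutator k x) \<in> I"
    by (simp add: z_def)
qed

text \<open>Put \<open>z = [u,v]\<close>.  Applying \<open>[v,\<sqdot>]\<close> to the central element
  \<open>[u,[v,vx]] = z [v,x] + v [u,[v,x]]\<close> shows \<open>z [v,[v,x]] = 0\<close>.  As \<open>z\<close> is central in a prime ring,
  either \<open>z = 0\<close>, or \<open>[v,[v,x]] = 0\<close> for all \<open>x\<close> and then \<open>v\<close> is central.\<close>

lemma commutator_zero_if_mixed_double_commutator_central:
  assumes I: "prime_ideal I"
    and uv: "commutator u v \<in> full_normalizer I"
    and uvx: "\<And>x. commutator u (commutator v x) \<in> full_normalizer I"
  shows "commutator u v \<in> I"
proof -
  have semi: "semiprime_ideal I" by (rule prime_ideal_semiprime[OF I])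
  note ideal = semiprime_ideal_two_sided[OF semi]
  note sub = two_sided_ideal_csubspace[OF ideal]
  have zc: "commutator y (commutator u v) \<in> I" for y
    using uv by (simp add: mem_full_normalizer_iff[OF sub])
  have cc: "commutator y (commutator u (commutator v x)) \<in> I" for x y
    using uvx by (simp add: mem_full_normalizer_iff[OF sub])
  have "commutator u v * commutator v (commutator v x)
    = commutator v (commutator u (commutator v (v * x)))
      - v * commutator v (commutator u (commutator v x))
      - commutator v (commutator u v) * commutator v x" for x
    by (simp add: commutator_def algebra_simps)
  then have zvvx: "commutator u v * commutator v (commutator v x) \<in> I" for x
    by (rule mem_if_eq) (intro zc cc two_sided_ideal_closed ideal)
  have "commutator u v * a * commutator v (commutator v x)
    = a * (commutator u v * commutator v (commutator v x))
      - commutator a (commutator u v) * commutator v (commutator v x)" for a x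
    by (simp add: commutator_def algebra_simps)
  then have "commutator u v * a * commutator v (commutator v x) \<in> I" for a x
    by (rule mem_if_eq) (intro zc zvvx two_sided_ideal_closed ideal)
  then have "commutator u v \<in> I \<or> (\<forall>x. commutator v (commutator v x) \<in> I)"
    using prime_ideal_elementwise[OF I] by metis
  then show ?thesis
    using full_normalizer_if_double_commutator_zero[OF semi, of v]
    by (auto simp: mem_full_normalizer_iff[OF sub])
qed

text \<open>This is Posner's argument for \<open>d = [u,\<sqdot>]\<close> and \<open>e = [v,\<sqdot>]\<close>.  If \<open>de = 0\<close> on \<open>A/I\<close>, then
  \<open>0 = de(xy) = d(x) e(y) + e(x) d(y)\<close>; for \<open>x = e(w)\<close> the first summand vanishes, so
  \<open>e\<^sup>2(w) d(y) = 0\<close>, and replacing \<open>y\<close> by \<open>yt\<close> yields \<open>e\<^sup>2(w) y d(t) = 0\<close>.  Primeness gives \<open>d = 0\<close> or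
  \<open>e\<^sup>2 = 0\<close>.\<close>

lemma full_normalizer_if_mixed_double_commutator_zero:
  assumes I: "prime_ideal I"
    and uvx: "\<And>x. commutator u (commutator v x) \<in> I"
  shows "u \<in> full_normalizer I \<or> v \<in> full_normalizer I"
proof -
  have semi: "semiprime_ideal I" by (rule prime_ideal_semiprime[OF I])
  note ideal = semiprime_ideal_two_sided[OF semi]
  note sub = two_sided_ideal_csubspace[OF ideal]
  have "commutator v (commutator v w) * commutator u y
    = commutator u (commutator v (commutator v w * y))
      - commutator u (commutator v (commutator v w)) * y
      - commutator u (commutator v w) * commutator v y
      - commutator v w * commutator u (commutator v y)" for w y
    by (simp add: commutator_def algebra_simps)
  then have prod: "commutator v (commutator v w) * commutator u y \<in> I" for w y
    by (rule mem_if_eq) (intro uvx two_sided_ideal_closed ideal)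
  have "commutator v (commutator v w) * y * commutator u t
    = commutator v (commutator v w) * commutator u (y * t)
      - commutator v (commutator v w) * commutator u y * t" for w y t
    by (simp add: commutator_def algebra_simps)
  then have "commutator v (commutator v w) * y * commutator u t \<in> I" for w y t
    by (rule mem_if_eq) (intro prod two_sided_ideal_closed ideal)
  then have "(\<forall>w. commutator v (commutator v w) \<in> I) \<or> (\<forall>t. commutator u t \<in> I)"
    using prime_ideal_elementwise[OF I] by metis
  then show ?thesis
  proof
    assume "\<forall>w. commutator v (commutator v w) \<in> I"
    then show ?thesis
      using full_normalizer_if_double_commutator_zero[OF semi, of v] by blast
  next
    assume "\<forall>t. commutator u t \<in> I"
    then show ?thesis
      using commutator_swap_mem[OF sub] by (simp add: mem_full_normalizer_iff[OF sub])
  qed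
qed

section \<open>Full normalizers and largest ideals\<close>

lemma subset_full_normalizer: "lie_ideal L \<Longrightarrow> L \<subseteq> full_normalizer L"
  by (auto simp: lie_ideal_iff mem_full_normalizer_iff)

lemma lie_ideal_full_normalizer:
  assumes "lie_ideal L"
  shows "lie_ideal (full_normalizer L)"
proof -
  have sub: "csubspace L" using assms by (simp add: lie_ideal_iff)
  note L = complex_vector.subspace_0[OF sub] complex_vector.subspace_add[OF sub]
    complex_vector.subspace_scale[OF sub]
  have "commutator x (a + b) \<in> L" if "commutator x a \<in> L" "commutator x b \<in> L" for x a b
    using L(2)[OF that] by (simp add: commutator_def algebra_simps)
  moreover have "commutator x (c *\<^sub>C a) \<in> L" if "commutator x a \<in> L" for x a c
    using L(3)[OF that, of c]
    by (simp add: commutator_def scaleC_mult_left scaleC_mult_right complex_vector.scale_right_diff_distrib)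
  ultimately have "csubspace (full_normalizer L)"
    using L(1) by (auto simp: commutator_def[of _ 0] complex_vector.subspace_def mem_full_normalizer_iff[OF sub])
  then show ?thesis
    using assms by (auto simp: lie_ideal_iff mem_full_normalizer_iff)
qed

text \<open>The reason is the identity \<open>[x,ab] = [xa,b] + [bx,a]\<close>.\<close>

lemma full_normalizer_mult:
  assumes sub: "csubspace L" and a: "a \<in> full_normalizer L" and b: "b \<in> full_normalizer L"
  shows "a * b \<in> full_normalizer L"
proof -
  have "commutator x (a * b) = commutator (x * a) b + commutator (b * x) a" for x
    by (simp add: commutator_def algebra_simps)
  then show ?thesis
    using a b complex_vector.subspace_add[OF sub] by (simp add: mem_full_normalizer_iff[OF sub])
qed

text \<open>The elements all of whose multiples lie in \<open>L\<close> form an ideal; this makes membership in the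
  largest ideal checkable element by element.\<close>

lemma mem_largest_idealI:
  assumes sub: "csubspace L"
    and w: "w \<in> L" "\<And>a. a * w \<in> L" "\<And>a. w * a \<in> L" "\<And>a b. a * w * b \<in> L"
  shows "w \<in> largest_ideal L"
proof -
  let ?J = "{w. w \<in> L \<and> (\<forall>a. a * w \<in> L) \<and> (\<forall>a. w * a \<in> L) \<and> (\<forall>a b. a * w * b \<in> L)}"
  have "two_sided_ideal ?J"
    using sub
    by (auto simp: two_sided_ideal_def complex_vector.subspace_def distrib_left distrib_right
        scaleC_mult_left scaleC_mult_right mult.assoc[symmetric])
      (metis mult.assoc)+
  then have "?J \<subseteq> largest_ideal L"
    by (rule largest_ideal(3)[OF sub]) blast
  then show ?thesis using w by blast
qed

text \<open>Since \<open>[x,y] a = [x,ya] - y [x,a]\<close>, a Lie ideal that is closed under multiplication contains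
  all right multiples of \<open>[x,y]\<close>.  Left and two-sided multiples differ from right multiples by
  commutators with elements already known to lie in \<open>L\<close>.\<close>

lemma commutator_in_largest_ideal:
  assumes L: "lie_ideal L" and mult: "\<And>a b. a \<in> L \<Longrightarrow> b \<in> L \<Longrightarrow> a * b \<in> L"
    and x: "x \<in> L" and y: "y \<in> L"
  shows "commutator x y \<in> largest_ideal L"
proof -
  have sub: "csubspace L" and lie: "\<And>a x. x \<in> L \<Longrightarrow> commutator a x \<in> L"
    using L by (auto simp: lie_ideal_iff)
  have eil: "commutator x a \<in> L" if "x \<in> L" for x a
    using commutator_swap_mem[OF sub] lie that by blast
  let ?w = "commutator x y"
  have w: "?w \<in> L" by (rule lie[OF y])
  have "?w * a = commutator x (y * a) - y * commutator x a" for a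
    by (simp add: commutator_def algebra_simps)
  then have right: "?w * a \<in> L" for a
    by (rule mem_if_eq) (intro complex_vector.subspace_diff[OF sub] eil x mult y)
  have "a * ?w = commutator a ?w + ?w * a" for a
    by (simp add: commutator_def algebra_simps)
  then have left: "a * ?w \<in> L" for a
    by (rule mem_if_eq) (intro complex_vector.subspace_add[OF sub] lie w right)
  have "a * ?w * b = commutator a (?w * b) + ?w * (b * a)" for a b
    by (simp add: commutator_def algebra_simps)
  then have "a * ?w * b \<in> L" for a b
    by (rule mem_if_eq) (intro complex_vector.subspace_add[OF sub] lie right)
  then show ?thesis
    by (intro mem_largest_idealI[OF sub] w left right)
qed

section \<open>Commutative ideals of the quotient\<close>

text \<open>The correspondence between ideals of \<open>A/I\<close> and ideals of \<open>A\<close> that contain \<open>I\<close> removes the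
  quotient from the discussion.\<close>

lemma quotient_no_commutative_ideal_iff:
  assumes I: "two_sided_ideal I"
  shows "quotient_no_commutative_ideal I \<longleftrightarrow>
    (\<forall>J. two_sided_ideal J \<longrightarrow> I \<subseteq> J \<longrightarrow> (\<forall>x\<in>J. \<forall>y\<in>J. commutator x y \<in> I) \<longrightarrow> J \<subseteq> I)"
    (is "_ \<longleftrightarrow> ?R")
proof
  assume no: "quotient_no_commutative_ideal I"
  show ?R
  proof (intro allI impI)
    fix J assume J: "two_sided_ideal J" and "I \<subseteq> J"
      and comm: "\<forall>x\<in>J. \<forall>y\<in>J. commutator x y \<in> I"
    note subJ = two_sided_ideal_csubspace[OF J]
    have "quotient_ideal I (coset I ` J)"
      unfolding quotient_ideal_def quotient_algebra_def
      using J complex_vector.subspace_0[OF subJ] complex_vector.subspace_scale[OF subJ]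
      by (auto simp: quotient_add_coset[OF I] quotient_scale_coset[OF I]
          quotient_mult_coset[OF I] two_sided_ideal_closed intro!: imageI)
    moreover have "\<forall>X\<in>coset I ` J. \<forall>Y\<in>coset I ` J. quotient_mult I X Y = quotient_mult I Y X"
      using comm by (auto simp: quotient_mult_coset[OF I] coset_eq_iff[OF I] commutator_def)
    ultimately have "coset I ` J = {coset I 0}"
      using no unfolding quotient_no_commutative_ideal_def by blast
    then show "J \<subseteq> I"
      by (metis coset_eq_iff[OF I] diff_zero imageI singletonD subsetI)
  qed
next
  assume R: ?R
  show "quotient_no_commutative_ideal I"
    unfolding quotient_no_commutative_ideal_def
  proof (rule notI, elim exE conjE)
    fix Q assume Q: "quotient_ideal I Q" and ne: "Q \<noteq> {coset I 0}"
      and comm: "\<forall>X\<in>Q. \<forall>Y\<in>Q. quotient_mult I X Y = quotient_mult I Y X"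
    define J where "J = {x. coset I x \<in> Q}"
    have zero: "coset I 0 \<in> Q"
      and add: "\<And>x y. coset I x \<in> Q \<Longrightarrow> coset I y \<in> Q \<Longrightarrow> coset I (x + y) \<in> Q"
      and scale: "\<And>c x. coset I x \<in> Q \<Longrightarrow> coset I (c *\<^sub>C x) \<in> Q"
      and mult: "\<And>a x. coset I x \<in> Q \<Longrightarrow> coset I (a * x) \<in> Q \<and> coset I (x * a) \<in> Q"
      using Q by (auto simp: quotient_ideal_def quotient_algebra_def quotient_add_coset[OF I, symmetric]
          quotient_scale_coset[OF I, symmetric] quotient_mult_coset[OF I, symmetric])
    have "two_sided_ideal J"
      using zero add scale mult
      by (auto simp: J_def two_sided_ideal_def complex_vector.subspace_def)
    moreover have "I \<subseteq> J"
      unfolding J_def using zero by (metis coset_eq_iff[OF I] diff_zero mem_Collect_eq subsetI)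
    moreover have "\<forall>x\<in>J. \<forall>y\<in>J. commutator x y \<in> I"
      using comm unfolding J_def commutator_def
      by (metis coset_eq_iff[OF I] quotient_mult_coset[OF I] mem_Collect_eq)
    ultimately have "J \<subseteq> I" using R by blast
    have "Q \<subseteq> {coset I 0}"
    proof
      fix X assume X: "X \<in> Q"
      then obtain x where x: "X = coset I x"
        using Q by (auto simp: quotient_ideal_def quotient_algebra_def)
      then have "x \<in> I" using X \<open>J \<subseteq> I\<close> by (auto simp: J_def)
      then show "X \<in> {coset I 0}" using coset_eq_iff[OF I, of x 0] x by simp
    qed
    then show False using zero ne by blast
  qed
qed

section \<open>From ideals to Lie ideals\<close>

lemma semiprime_lie_ideal_full_normalizer:
  assumes I: "semiprime_ideal I"
  shows "semiprime_lie_ideal (full_normalizer I)"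
proof -
  have T: "lie_ideal (full_normalizer I)"
    by (intro lie_ideal_full_normalizer two_sided_ideal_lie_ideal semiprime_ideal_two_sided I)
  then have sub: "csubspace (full_normalizer I)" by (simp add: lie_ideal_iff)
  have "K \<subseteq> full_normalizer I"
    if K: "lie_ideal K" and KK: "commutator_span K K \<subseteq> full_normalizer I" for K
  proof
    fix k assume k: "k \<in> K"
    have "commutator k x \<in> K" for x
      using K k commutator_swap_mem[of K] by (auto simp: lie_ideal_iff)
    then show "k \<in> full_normalizer I"
      using KK k unfolding commutator_span_subset_iff[OF sub]
      by (blast intro: full_normalizer_if_double_commutator_central[OF I])
  qed
  then show ?thesis using T by (simp add: semiprime_lie_ideal_def)
qed

text \<open>Modulo \<open>I\<close>, the largest ideal inside \<open>T(I)\<close> is central and hence commutative.\<close>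

lemma largest_ideal_full_normalizer:
  assumes I: "two_sided_ideal I" and no: "quotient_no_commutative_ideal I"
  shows "largest_ideal (full_normalizer I) = I"
proof -
  note sub = two_sided_ideal_csubspace[OF I]
  note lie = two_sided_ideal_lie_ideal[OF I]
  have subT: "csubspace (full_normalizer I)"
    using lie_ideal_full_normalizer[OF lie] by (simp add: lie_ideal_iff)
  let ?J = "largest_ideal (full_normalizer I)"
  have IJ: "I \<subseteq> ?J"
    by (rule largest_ideal(3)[OF subT I subset_full_normalizer[OF lie]])
  have "\<forall>x\<in>?J. \<forall>y\<in>?J. commutator x y \<in> I"
    using largest_ideal(2)[OF subT] mem_full_normalizer_iff[OF sub] by blast
  then have "?J \<subseteq> I"
    using no largest_ideal(1)[OF subT] IJ by (simp add: quotient_no_commutative_ideal_iff[OF I])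
  then show ?thesis using IJ by blast
qed

lemma prime_lie_ideal_full_normalizer:
  assumes I: "prime_ideal I" and no: "quotient_no_commutative_ideal I"
  shows "prime_lie_ideal (full_normalizer I)"
proof -
  have ideal: "two_sided_ideal I" using I by (simp add: prime_ideal_def)
  note sub = two_sided_ideal_csubspace[OF ideal]
  have T: "lie_ideal (full_normalizer I)"
    by (intro lie_ideal_full_normalizer two_sided_ideal_lie_ideal ideal)
  then have subT: "csubspace (full_normalizer I)" by (simp add: lie_ideal_iff)
  have "full_normalizer I \<noteq> UNIV"
  proof
    assume UNIV: "full_normalizer I = UNIV"
    have "two_sided_ideal (UNIV :: 'a set)"
      by (simp add: two_sided_ideal_def)
    then have "UNIV \<subseteq> largest_ideal (full_normalizer I)"
      by (rule largest_ideal(3)[OF subT]) (simp add: UNIV)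
    then show False
      using I by (auto simp: largest_ideal_full_normalizer[OF ideal no] prime_ideal_def)
  qed
  moreover have "K1 \<subseteq> full_normalizer I \<or> K2 \<subseteq> full_normalizer I"
    if K1: "lie_ideal K1" and K2: "lie_ideal K2"
      and "commutator_span K1 K2 \<subseteq> full_normalizer I" for K1 K2
  proof -
    have bracket: "commutator u v \<in> full_normalizer I" if "u \<in> K1" "v \<in> K2" for u v
      using that \<open>commutator_span K1 K2 \<subseteq> full_normalizer I\<close>
      by (simp add: commutator_span_subset_iff[OF subT])
    have stable: "commutator v x \<in> K2" if "v \<in> K2" for v x
      using K2 that commutator_swap_mem[of K2] by (auto simp: lie_ideal_iff)
    have zero: "commutator u v \<in> I" if "u \<in> K1" "v \<in> K2" for u v
      using that by (intro commutator_zero_if_mixed_double_commutator_central[OF I] bracket stable)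
    have "u \<in> full_normalizer I \<or> v \<in> full_normalizer I" if "u \<in> K1" "v \<in> K2" for u v
      using that by (intro full_normalizer_if_mixed_double_commutator_zero[OF I] zero stable)
    then show ?thesis by blast
  qed
  ultimately show ?thesis using T by (simp add: prime_lie_ideal_def)
qed

section \<open>From Lie ideals to ideals\<close>

lemma semiprime_lie_idealD:
  assumes "semiprime_lie_ideal L" "lie_ideal K" "\<And>x y. x \<in> K \<Longrightarrow> y \<in> K \<Longrightarrow> commutator x y \<in> L"
  shows "K \<subseteq> L"
  using assms by (simp add: semiprime_lie_ideal_def lie_ideal_iff commutator_span_subset_iff)

text \<open>An ideal \<open>J\<close> that is commutative modulo \<open>I(L)\<close> satisfies \<open>[J,J] \<subseteq> L\<close> and therefore lies in \<open>L\<close>,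
  hence in \<open>I(L)\<close>.  This covers both claims, since \<open>J\<^sup>2 \<subseteq> I(L)\<close> makes \<open>J\<close> commutative modulo \<open>I(L)\<close>.\<close>

lemma semiprime_ideal_largest_ideal:
  assumes L: "semiprime_lie_ideal L"
  shows "semiprime_ideal (largest_ideal L)"
    and "quotient_no_commutative_ideal (largest_ideal L)"
proof -
  have sub: "csubspace L" using L by (simp add: semiprime_lie_ideal_def lie_ideal_iff)
  note I = largest_ideal(1)[OF sub]
  note subI = two_sided_ideal_csubspace[OF I]
  have commutative: "J \<subseteq> largest_ideal L"
    if J: "two_sided_ideal J" and "\<And>x y. x \<in> J \<Longrightarrow> y \<in> J \<Longrightarrow> commutator x y \<in> largest_ideal L" for J
    using that largest_ideal(2)[OF sub]
    by (intro largest_ideal(3)[OF sub J] semiprime_lie_idealD[OF L two_sided_ideal_lie_ideal[OF J]])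
      blast
  show "semiprime_ideal (largest_ideal L)"
    unfolding semiprime_ideal_def
    using I commutative
    by (simp add: ideal_product_subset_iff[OF subI] two_sided_ideal_diff commutator_def)
  show "quotient_no_commutative_ideal (largest_ideal L)"
    using commutative by (simp add: quotient_no_commutative_ideal_iff[OF I])
qed

lemma full_normalizer_largest_ideal:
  assumes L: "semiprime_lie_ideal L"
  shows "full_normalizer (largest_ideal L) = L"
proof
  have lie: "lie_ideal L" using L by (simp add: semiprime_lie_ideal_def)
  then have sub: "csubspace L" by (simp add: lie_ideal_iff)
  note I = largest_ideal(1)[OF sub]
  note subI = two_sided_ideal_csubspace[OF I]
  note semi = semiprime_ideal_largest_ideal(1)[OF L]
  show "full_normalizer (largest_ideal L) \<subseteq> L"
  proof (rule semiprime_lie_idealD[OF L lie_ideal_full_normalizer[OF two_sided_ideal_lie_ideal[OF I]]])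
    fix x y
    assume "y \<in> full_normalizer (largest_ideal L)"
    then show "commutator x y \<in> L"
      using largest_ideal(2)[OF sub] by (auto simp: mem_full_normalizer_iff[OF subI])
  qed
  have "full_normalizer L \<subseteq> L"
    by (rule semiprime_lie_idealD[OF L lie_ideal_full_normalizer[OF lie]])
      (simp add: mem_full_normalizer_iff[OF sub])
  then have "full_normalizer L = L"
    using subset_full_normalizer[OF lie] by blast
  then have mult: "a * b \<in> L" if "a \<in> L" "b \<in> L" for a b
    using full_normalizer_mult[OF sub, of a b] that by simp
  show "L \<subseteq> full_normalizer (largest_ideal L)"
  proof
    fix k assume k: "k \<in> L"
    have "commutator k x \<in> L" for x
      using lie k commutator_swap_mem[OF sub] by (simp add: lie_ideal_iff)
    then show "k \<in> full_normalizer (largest_ideal L)"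
      by (intro full_normalizer_if_double_commutator_zero[OF semi]
          commutator_in_largest_ideal[OF lie mult k])
  qed
qed

lemma prime_lie_ideal_semiprime: "prime_lie_ideal L \<Longrightarrow> semiprime_lie_ideal L"
  by (auto simp: prime_lie_ideal_def semiprime_lie_ideal_def)

text \<open>Primeness for Lie ideals is symmetric, while \<open>J K \<subseteq> I\<close> controls only one of the two products
  in \<open>[J,K]\<close>.  Semiprimeness supplies the other: \<open>(yx) a (yx) = y (xay) x\<close> lies in \<open>I\<close> for
  \<open>x \<in> J\<close> and \<open>y \<in> K\<close>, so \<open>K J \<subseteq> I\<close>.\<close>

lemma prime_ideal_largest_ideal:
  assumes L: "prime_lie_ideal L"
  shows "prime_ideal (largest_ideal L)"
proof -
  note Ls = prime_lie_ideal_semiprime[OF L]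
  have sub: "csubspace L" using L by (simp add: prime_lie_ideal_def lie_ideal_iff)
  note I = largest_ideal(1)[OF sub]
  note semi = semiprime_ideal_largest_ideal(1)[OF Ls]
  have "J \<subseteq> largest_ideal L \<or> K \<subseteq> largest_ideal L"
    if J: "two_sided_ideal J" and K: "two_sided_ideal K"
      and JK: "ideal_product J K \<subseteq> largest_ideal L" for J K
  proof -
    have xy: "x * y \<in> largest_ideal L" if "x \<in> J" "y \<in> K" for x y
      using JK that by (simp add: ideal_product_subset_iff[OF two_sided_ideal_csubspace[OF I]])
    have yx: "y * x \<in> largest_ideal L" if "x \<in> J" "y \<in> K" for x y
    proof (rule semiprime_ideal_elementwise[OF semi])
      fix a
      have "y * (x * a * y) * x \<in> largest_ideal L"
        using that by (intro two_sided_ideal_closed I xy J)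
      then show "y * x * a * (y * x) \<in> largest_ideal L"
        by (simp add: mult.assoc)
    qed
    have "\<forall>x\<in>J. \<forall>y\<in>K. commutator x y \<in> L"
      using xy yx two_sided_ideal_diff[OF I] largest_ideal(2)[OF sub]
      unfolding commutator_def by blast
    then have "J \<subseteq> L \<or> K \<subseteq> L"
      using L J[THEN two_sided_ideal_lie_ideal] K[THEN two_sided_ideal_lie_ideal]
      unfolding prime_lie_ideal_def commutator_span_subset_iff[OF sub] by blast
    then show ?thesis
      using largest_ideal(3)[OF sub] J K by blast
  qed
  moreover have "largest_ideal L \<noteq> UNIV"
    using L largest_ideal(2)[OF sub] by (auto simp: prime_lie_ideal_def)
  ultimately show ?thesis
    using I by (simp add: prime_ideal_def)
qed

section \<open>The bijection\<close>

theorem theorem2p11: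
  shows "(bij_betw full_normalizer
      {I :: 'a::cstar_algebra set. semiprime_ideal I \<and> quotient_no_commutative_ideal I}
      {L :: 'a set. semiprime_lie_ideal L})
  \<and> (\<forall>L :: 'a set. semiprime_lie_ideal L \<longrightarrow>
      inv_into {I. semiprime_ideal I \<and> quotient_no_commutative_ideal I} full_normalizer L
        = largest_ideal L)
  \<and> ({I :: 'a set. prime_ideal I \<and> quotient_no_commutative_ideal I}
      \<subseteq> {I. semiprime_ideal I \<and> quotient_no_commutative_ideal I})
  \<and> ({L :: 'a set. prime_lie_ideal L} \<subseteq> {L. semiprime_lie_ideal L})
  \<and> (bij_betw full_normalizer
      {I :: 'a set. prime_ideal I \<and> quotient_no_commutative_ideal I}
      {L :: 'a set. prime_lie_ideal L})"
proof -
  let ?a = "{I :: 'a set. semiprime_ideal I \<and> quotient_no_commutative_ideal I}"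
  let ?a' = "{I :: 'a set. prime_ideal I \<and> quotient_no_commutative_ideal I}"
  have bij: "bij_betw full_normalizer ?a {L :: 'a set. semiprime_lie_ideal L}"
    by (rule bij_betw_byWitness[where f' = largest_ideal])
      (auto simp: largest_ideal_full_normalizer semiprime_ideal_two_sided
        full_normalizer_largest_ideal semiprime_lie_ideal_full_normalizer
        semiprime_ideal_largest_ideal)
  have inverse: "inv_into ?a full_normalizer L = largest_ideal L" if "semiprime_lie_ideal L" for L
    using that
    by (intro inv_into_f_eq bij_betw_imp_inj_on[OF bij])
      (simp_all add: semiprime_ideal_largest_ideal full_normalizer_largest_ideal)
  have bij': "bij_betw full_normalizer ?a' {L :: 'a set. prime_lie_ideal L}"
    by (rule bij_betw_byWitness[where f' = largest_ideal])
      (auto simp: largest_ideal_full_normalizer prime_ideal_semiprime semiprime_ideal_two_sided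
        full_normalizer_largest_ideal prime_lie_ideal_semiprime prime_lie_ideal_full_normalizer
        prime_ideal_largest_ideal semiprime_ideal_largest_ideal)
  show ?thesis
    using bij inverse bij' prime_ideal_semiprime prime_lie_ideal_semiprime by blast
qed

end
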